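(* Let $I\subset\mathbb{R}$ be an open interval and let $\gamma:I\to\mathbb{H}_3$ be a smooth curve parametrized by arc length in the Heisenberg group $(\mathbb{H}_3,g)$, with geodesic curvature $k$, geodesic torsion $\tau$ and Frenet frame $\{T,N,B\}$. Then $\gamma$ is a non-geodesic biharmonic curve if and only if $$ \begin{cases} k=\text{constant}\neq 0,\\ k^2+\tau^2=\frac14-B_3^2,\\ \tau'=N_3B_3 \end{cases} $$ on $I$.
   Context: The Heisenberg group $\mathbb{H}_3$ is $\mathbb{R}^3$ with the multiplication $(\tilde x,\tilde y,\tilde z)(x,y,z)=(\tilde x+x,\tilde y+y,\tilde z+z+\frac12\tilde x y-\frac12\tilde y x)$ and the left-invariant Riemannian metric $g=dx^2+dy^2+(dz+\frac y2dx-\frac x2dy)^2$. A left-invariant orthonormal frame, taken as positively oriented, is $e_1=\partial_x-\frac12y\,\partial_z$, $e_2=\partial_y+\frac12x\,\partial_z$, $e_3=\partial_z$. $\nabla$ is the Levi-Civita connection of $g$, and the curvature sign convention is $R(X,Y)Z=-\nabla_X\nabla_YZ+\nabla_Y\nabla_XZ+\nabla_{[X,Y]}Z$. Everything is smooth ($C^\infty$). For a curve $\gamma$ parametrized by arc length with $T=\gamma'$: $\gamma$ is a geodesic if $\nabla_TT=0$ identically, and non-geodesic otherwise; $\gamma$ is biharmonic if $\tau_2(\gamma)=\nabla_T\nabla_T\nabla_TT+R(T,\nabla_TT)T=0$. Frenet apparatus: $k=|\nabla_TT|$ is the geodesic curvature; where $k\neq0$, $N$ is the unit vector field with $\nabla_TT=kN$,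 $B=T\times N$ (so that $\{T,N,B\}$ is a positively oriented orthonormal frame), and the geodesic torsion $\tau$ is defined by the Frenet equations $\nabla_TT=kN$, $\nabla_TN=-kT-\tau B$, $\nabla_TB=\tau N$. Components are taken with respect to $e_1,e_2,e_3$: $T=\sum T_ie_i$, $N=\sum N_ie_i$, $B=\sum B_ie_i$. $N$, $B$, $\tau$ are defined only where $k\ne0$ (which is guaranteed once $k$ is a nonzero constant). *)

theory Defs
  imports "HOL-Analysis.Analysis"
begin

section \<open>Riemannian metrics on \<open>\<real>\<^sup>n\<close> in the global chart\<close>

text \<open>
  Tangent spaces are identified with \<open>\<real>\<^sup>n\<close> through the coordinate frame (\<open>axis i 1\<close> is the
  \<open>i\<close>-th coordinate vector field); \<open>g p u v\<close> is the inner product of \<open>u\<close> and \<open>v\<close> at \<open>p\<close>.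
\<close>

type_synonym 'n metric = "real^'n \<Rightarrow> real^'n \<Rightarrow> real^'n \<Rightarrow> real"
type_synonym 'n vfield = "real^'n \<Rightarrow> real^'n"

definition gram :: "('n::finite) metric \<Rightarrow> real^'n \<Rightarrow> real^'n^'n" where
  "gram g p = (\<chi> i j. g p (axis i 1) (axis j 1))"

definition partial :: "'n::finite \<Rightarrow> (real^'n \<Rightarrow> real) \<Rightarrow> real^'n \<Rightarrow> real" where
  "partial i f p = frechet_derivative f (at p) (axis i 1)"

definition christoffel :: "('n::finite) metric \<Rightarrow> real^'n \<Rightarrow> 'n \<Rightarrow> 'n \<Rightarrow> 'n \<Rightarrow> real" where
  "christoffel g p l i j =
     1/2 * (\<Sum>m\<in>UNIV. matrix_inv (gram g p) $ l $ m *
        (partial i (\<lambda>q. gram g q $ j $ m) p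
       + partial j (\<lambda>q. gram g q $ i $ m) p
       - partial m (\<lambda>q. gram g q $ i $ j) p))"

definition christoffel_form :: "('n::finite) metric \<Rightarrow> real^'n \<Rightarrow> real^'n \<Rightarrow> real^'n \<Rightarrow> real^'n" where
  "christoffel_form g p u v = (\<chi> l. \<Sum>i\<in>UNIV. \<Sum>j\<in>UNIV. christoffel g p l i j * u $ i * v $ j)"

text \<open>
  The Levi-Civita connection \<open>\<nabla>\<^sub>X Y\<close> of \<open>g\<close>.  Lemmas \<open>levi_civita_torsion_free\<close> and
  \<open>levi_civita_metric\<close> below are its characteristic properties.
\<close>

definition levi_civita :: "('n::finite) metric \<Rightarrow> 'n vfield \<Rightarrow> 'n vfield \<Rightarrow> 'n vfield" where
  "levi_civita g X Y p = frechet_derivative Y (at p) (X p) + christoffel_form g p (X p) (Y p)"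

definition lie_bracket :: "('n::finite) vfield \<Rightarrow> 'n vfield \<Rightarrow> 'n vfield" where
  "lie_bracket X Y p = frechet_derivative Y (at p) (X p) - frechet_derivative X (at p) (Y p)"

text \<open>Curvature, with the sign \<open>R(X,Y)Z = -\<nabla>\<^sub>X\<nabla>\<^sub>Y Z + \<nabla>\<^sub>Y\<nabla>\<^sub>X Z + \<nabla>\<^bsub>[X,Y]\<^esub> Z\<close>.\<close>

definition riemann :: "('n::finite) metric \<Rightarrow> 'n vfield \<Rightarrow> 'n vfield \<Rightarrow> 'n vfield \<Rightarrow> 'n vfield" where
  "riemann g X Y Z p =
     - levi_civita g X (levi_civita g Y Z) p
     + levi_civita g Y (levi_civita g X Z) p
     + levi_civita g (lie_bracket X Y) Z p"

text \<open>
  \<open>R\<close> is tensorial, so its value on tangent vectors at \<open>p\<close> may be computed from any extension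
  of them to smooth vector fields; the extension with constant coordinates is used here.
\<close>

definition riemann_at :: "('n::finite) metric \<Rightarrow> real^'n \<Rightarrow> real^'n \<Rightarrow> real^'n \<Rightarrow> real^'n \<Rightarrow> real^'n" where
  "riemann_at g p u v w = riemann g (\<lambda>_. u) (\<lambda>_. v) (\<lambda>_. w) p"


section \<open>Curves\<close>

abbreviation velocity :: "(real \<Rightarrow> real^'n) \<Rightarrow> real \<Rightarrow> real^('n::finite)" where
  "velocity \<gamma> t \<equiv> vector_derivative \<gamma> (at t)"

text \<open>\<open>C\<^sup>\<infinity>\<close> on \<open>I\<close>, intended for open \<open>I\<close>: all iterated derivatives exist on \<open>I\<close>.\<close>

definition smooth_curve_on :: "real set \<Rightarrow> (real \<Rightarrow> real^('n::finite)) \<Rightarrow> bool" where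
  "smooth_curve_on I \<gamma> \<longleftrightarrow> (\<forall>n. \<forall>t\<in>I. (velocity ^^ n) \<gamma> differentiable (at t))"

definition arc_length_param_on :: "('n::finite) metric \<Rightarrow> real set \<Rightarrow> (real \<Rightarrow> real^'n) \<Rightarrow> bool" where
  "arc_length_param_on g I \<gamma> \<longleftrightarrow> (\<forall>t\<in>I. sqrt (g (\<gamma> t) (velocity \<gamma> t) (velocity \<gamma> t)) = 1)"

text \<open>
  The covariant derivative \<open>\<nabla>\<^sub>T V\<close> of a vector field \<open>V\<close> along \<open>\<gamma>\<close>, \<open>T = \<gamma>'\<close>; lemma
  \<open>cov_along_extension\<close> relates it to \<open>levi_civita\<close>.
\<close>

definition cov_along :: "('n::finite) metric \<Rightarrow> (real \<Rightarrow> real^'n) \<Rightarrow> (real \<Rightarrow> real^'n) \<Rightarrow> real \<Rightarrow> real^'n" where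
  "cov_along g \<gamma> V t = vector_derivative V (at t) + christoffel_form g (\<gamma> t) (velocity \<gamma> t) (V t)"

definition geodesic_on :: "('n::finite) metric \<Rightarrow> real set \<Rightarrow> (real \<Rightarrow> real^'n) \<Rightarrow> bool" where
  "geodesic_on g I \<gamma> \<longleftrightarrow> (\<forall>t\<in>I. cov_along g \<gamma> (velocity \<gamma>) t = 0)"

definition bitension :: "('n::finite) metric \<Rightarrow> (real \<Rightarrow> real^'n) \<Rightarrow> real \<Rightarrow> real^'n" where
  "bitension g \<gamma> t =
     cov_along g \<gamma> (cov_along g \<gamma> (cov_along g \<gamma> (velocity \<gamma>))) t
     + riemann_at g (\<gamma> t) (velocity \<gamma> t) (cov_along g \<gamma> (velocity \<gamma>) t) (velocity \<gamma> t)"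

definition biharmonic_on :: "('n::finite) metric \<Rightarrow> real set \<Rightarrow> (real \<Rightarrow> real^'n) \<Rightarrow> bool" where
  "biharmonic_on g I \<gamma> \<longleftrightarrow> (\<forall>t\<in>I. bitension g \<gamma> t = 0)"

definition geodesic_curvature :: "('n::finite) metric \<Rightarrow> (real \<Rightarrow> real^'n) \<Rightarrow> real \<Rightarrow> real" where
  "geodesic_curvature g \<gamma> t =
     sqrt (g (\<gamma> t) (cov_along g \<gamma> (velocity \<gamma>) t) (cov_along g \<gamma> (velocity \<gamma>) t))"


section \<open>The Heisenberg group\<close>

definition heis_mult :: "real^3 \<Rightarrow> real^3 \<Rightarrow> real^3" where
  "heis_mult a p = vector [a$1 + p$1, a$2 + p$2, a$3 + p$3 + 1/2 * a$1 * p$2 - 1/2 * a$2 * p$1]"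

text \<open>\<open>g = dx\<^sup>2 + dy\<^sup>2 + (dz + y/2 dx - x/2 dy)\<^sup>2\<close> in polarized form.\<close>

definition heis_metric :: "3 metric" where
  "heis_metric p u v =
     u$1 * v$1 + u$2 * v$2
     + (u$3 + p$2 / 2 * u$1 - p$1 / 2 * u$2) * (v$3 + p$2 / 2 * v$1 - p$1 / 2 * v$2)"

text \<open>\<open>heis_frame p $ i\<close> is the value of \<open>e\<^sub>i\<close> at \<open>p\<close>.\<close>

definition heis_frame :: "real^3 \<Rightarrow> real^3^3" where
  "heis_frame p = vector [vector [1, 0, - (1/2) * p$2], vector [0, 1, 1/2 * p$1], vector [0, 0, 1]]"

text \<open>Components with respect to the orthonormal frame \<open>e\<^sub>1, e\<^sub>2, e\<^sub>3\<close>.\<close>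

definition heis_comp :: "real^3 \<Rightarrow> real^3 \<Rightarrow> real^3" where
  "heis_comp p u = (\<chi> i. heis_metric p u (heis_frame p $ i))"

text \<open>The cross product of tangent vectors at \<open>p\<close> for which \<open>e\<^sub>1, e\<^sub>2, e\<^sub>3\<close> is positively oriented.\<close>

definition heis_cross :: "real^3 \<Rightarrow> real^3 \<Rightarrow> real^3 \<Rightarrow> real^3" where
  "heis_cross p u v = (\<Sum>i\<in>UNIV. cross3 (heis_comp p u) (heis_comp p v) $ i *\<^sub>R heis_frame p $ i)"

text \<open>
  Frenet apparatus.  \<open>heis_N\<close>, \<open>heis_B\<close> and \<open>heis_torsion\<close> are meaningful only at parameters
  where the geodesic curvature does not vanish.
\<close>

abbreviation heis_nabla :: "(real \<Rightarrow> real^3) \<Rightarrow> (real \<Rightarrow> real^3) \<Rightarrow> real \<Rightarrow> real^3" where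
  "heis_nabla \<equiv> cov_along heis_metric"

abbreviation heis_curvature :: "(real \<Rightarrow> real^3) \<Rightarrow> real \<Rightarrow> real" where
  "heis_curvature \<equiv> geodesic_curvature heis_metric"

definition heis_N :: "(real \<Rightarrow> real^3) \<Rightarrow> real \<Rightarrow> real^3" where
  "heis_N \<gamma> t = (1 / heis_curvature \<gamma> t) *\<^sub>R heis_nabla \<gamma> (velocity \<gamma>) t"

definition heis_B :: "(real \<Rightarrow> real^3) \<Rightarrow> real \<Rightarrow> real^3" where
  "heis_B \<gamma> t = heis_cross (\<gamma> t) (velocity \<gamma> t) (heis_N \<gamma> t)"

definition heis_torsion :: "(real \<Rightarrow> real^3) \<Rightarrow> real \<Rightarrow> real" where
  "heis_torsion \<gamma> t = (THE r.
      heis_nabla \<gamma> (heis_N \<gamma>) t = - heis_curvature \<gamma> t *\<^sub>R velocity \<gamma> t - r *\<^sub>R heis_B \<gamma> t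
    \<and> heis_nabla \<gamma> (heis_B \<gamma>) t = r *\<^sub>R heis_N \<gamma> t)"


section \<open>Consistency of the definitions\<close>

lemma frechet_zero_const [simp]: "frechet_derivative (\<lambda>_. c) (at p) = (\<lambda>_. 0)"
  by (rule frechet_derivative_at [symmetric]) simp

lemma christoffel_sym:
  assumes "\<And>p u v. g p u v = g p v u"
  shows "christoffel g p l i j = christoffel g p l j i"
proof -
  have "gram g q $ i $ j = gram g q $ j $ i" for q i j
    using assms by (simp add: gram_def)
  then show ?thesis by (simp add: christoffel_def add.commute)
qed

lemma levi_civita_torsion_free:
  assumes "\<And>p u v. g p u v = g p v u"
  shows "levi_civita g X Y p - levi_civita g Y X p = lie_bracket X Y p"
proof -
  have "christoffel_form g p u v = christoffel_form g p v u" for u v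
  proof -
    have "(\<Sum>i\<in>UNIV. \<Sum>j\<in>UNIV. christoffel g p l i j * u $ i * v $ j)
        = (\<Sum>i\<in>UNIV. \<Sum>j\<in>UNIV. christoffel g p l i j * v $ i * u $ j)" for l
      by (subst sum.swap, intro sum.cong refl)
         (subst christoffel_sym [where g=g, OF assms], simp)
    then show ?thesis by (simp add: christoffel_form_def)
  qed
  then show ?thesis by (simp add: levi_civita_def lie_bracket_def)
qed

lemma gram_christoffel:
  assumes sym: "\<And>p u v. g p u v = g p v u" and inv: "invertible (gram g p)"
  shows "(\<Sum>l\<in>UNIV. gram g p $ k $ l * christoffel g p l i j) =
     1/2 * (partial i (\<lambda>q. gram g q $ j $ k) p + partial j (\<lambda>q. gram g q $ i $ k) p
            - partial k (\<lambda>q. gram g q $ i $ j) p)"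
proof -
  define c where "c m = partial i (\<lambda>q. gram g q $ j $ m) p + partial j (\<lambda>q. gram g q $ i $ m) p
            - partial m (\<lambda>q. gram g q $ i $ j) p" for m
  have I: "gram g p ** matrix_inv (gram g p) = mat 1"
    unfolding matrix_inv_def
    by (rule someI2_ex) (use inv in \<open>auto simp: invertible_def\<close>)
  have "(\<Sum>l\<in>UNIV. gram g p $ k $ l * christoffel g p l i j)
      = 1/2 * (\<Sum>l\<in>UNIV. \<Sum>m\<in>UNIV. gram g p $ k $ l * matrix_inv (gram g p) $ l $ m * c m)"
    by (simp add: christoffel_def c_def [symmetric] sum_distrib_left mult_ac)
  also have "\<dots> = 1/2 * (\<Sum>m\<in>UNIV. (gram g p ** matrix_inv (gram g p)) $ k $ m * c m)"
    by (subst sum.swap) (simp add: matrix_matrix_mult_def sum_distrib_right)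
  also have "\<dots> = 1/2 * c k"
    by (simp add: I mat_def if_distrib [where f="\<lambda>x. x * _"] cong: if_cong)
  finally show ?thesis by (simp add: c_def)
qed

lemma metric_eq_gram:
  assumes "bilinear (g p)"
  shows "g p u v = (\<Sum>i\<in>UNIV. \<Sum>j\<in>UNIV. gram g p $ i $ j * u $ i * v $ j)"
proof -
  have "g p u v = g p (\<Sum>i\<in>UNIV. u $ i *\<^sub>R axis i 1) (\<Sum>j\<in>UNIV. v $ j *\<^sub>R axis j 1)"
    by (simp add: basis_expansion flip: scalar_mult_eq_scaleR)
  also have "\<dots> = (\<Sum>(i,j)\<in>UNIV \<times> UNIV. g p (u $ i *\<^sub>R axis i 1) (v $ j *\<^sub>R axis j 1))"
    by (rule bilinear_sum [OF assms])
  also have "\<dots> = (\<Sum>i\<in>UNIV. \<Sum>j\<in>UNIV. gram g p $ i $ j * u $ i * v $ j)"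
    by (subst sum.cartesian_product [symmetric])
       (simp add: gram_def bilinear_lmul [OF assms] bilinear_rmul [OF assms] mult_ac)
  finally show ?thesis .
qed

lemma partial_expand:
  assumes "f differentiable (at p)"
  shows "frechet_derivative f (at p) w = (\<Sum>k\<in>UNIV. w $ k * partial k f p)"
proof -
  have lin: "linear (frechet_derivative f (at p))"
    using assms linear_frechet_derivative by blast
  have "frechet_derivative f (at p) w = frechet_derivative f (at p) (\<Sum>k\<in>UNIV. w $ k *\<^sub>R axis k 1)"
    by (simp add: basis_expansion flip: scalar_mult_eq_scaleR)
  then show ?thesis
    by (simp add: linear_sum [OF lin] linear_cmul [OF lin] partial_def)
qed

lemma gram_christoffel_form:
  assumes sym: "\<And>p u v. g p u v = g p v u" and bil: "bilinear (g p)"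
    and inv: "invertible (gram g p)"
  shows "g p (christoffel_form g p w u) v = 1/2 * (\<Sum>k\<in>UNIV. \<Sum>i\<in>UNIV. \<Sum>j\<in>UNIV.
      (partial k (\<lambda>q. gram g q $ i $ j) p + partial i (\<lambda>q. gram g q $ k $ j) p
        - partial j (\<lambda>q. gram g q $ k $ i) p) * w $ k * u $ i * v $ j)"
proof -
  have gs: "gram g p $ i $ j = gram g p $ j $ i" for i j
    using sym by (simp add: gram_def)
  have "g p (christoffel_form g p w u) v
      = (\<Sum>l\<in>UNIV. \<Sum>j\<in>UNIV. \<Sum>k\<in>UNIV. \<Sum>i\<in>UNIV.
           gram g p $ j $ l * christoffel g p l k i * w $ k * u $ i * v $ j)"
    by (simp add: metric_eq_gram [where g=g, OF bil] christoffel_form_def sum_distrib_left sum_distrib_right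
        gs [of _ _] mult_ac)
  also have "\<dots> = (\<Sum>j\<in>UNIV. \<Sum>l\<in>UNIV. \<Sum>k\<in>UNIV. \<Sum>i\<in>UNIV.
           gram g p $ j $ l * christoffel g p l k i * w $ k * u $ i * v $ j)"
    by (rule sum.swap)
  also have "\<dots> = (\<Sum>j\<in>UNIV. \<Sum>k\<in>UNIV. \<Sum>l\<in>UNIV. \<Sum>i\<in>UNIV.
           gram g p $ j $ l * christoffel g p l k i * w $ k * u $ i * v $ j)"
    by (intro sum.cong refl sum.swap)
  also have "\<dots> = (\<Sum>j\<in>UNIV. \<Sum>k\<in>UNIV. \<Sum>i\<in>UNIV. \<Sum>l\<in>UNIV.
           gram g p $ j $ l * christoffel g p l k i * w $ k * u $ i * v $ j)"
    by (intro sum.cong refl sum.swap)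
  also have "\<dots> = (\<Sum>j\<in>UNIV. \<Sum>k\<in>UNIV. \<Sum>i\<in>UNIV. 1/2 *
      (partial k (\<lambda>q. gram g q $ i $ j) p + partial i (\<lambda>q. gram g q $ k $ j) p
        - partial j (\<lambda>q. gram g q $ k $ i) p) * w $ k * u $ i * v $ j)"
    by (simp add: gram_christoffel [OF sym inv] flip: sum_distrib_right)
  also have "\<dots> = (\<Sum>k\<in>UNIV. \<Sum>j\<in>UNIV. \<Sum>i\<in>UNIV. 1/2 *
      (partial k (\<lambda>q. gram g q $ i $ j) p + partial i (\<lambda>q. gram g q $ k $ j) p
        - partial j (\<lambda>q. gram g q $ k $ i) p) * w $ k * u $ i * v $ j)"
    by (rule sum.swap)
  also have "\<dots> = (\<Sum>k\<in>UNIV. \<Sum>i\<in>UNIV. \<Sum>j\<in>UNIV. 1/2 *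
      (partial k (\<lambda>q. gram g q $ i $ j) p + partial i (\<lambda>q. gram g q $ k $ j) p
        - partial j (\<lambda>q. gram g q $ k $ i) p) * w $ k * u $ i * v $ j)"
    by (intro sum.cong refl sum.swap)
  finally show ?thesis by (simp add: sum_distrib_left mult.assoc)
qed

lemma levi_civita_metric:
  assumes sym: "\<And>p u v. g p u v = g p v u" and bil: "\<And>p. bilinear (g p)"
    and inv: "invertible (gram g p)"
    and smooth: "\<And>i j. (\<lambda>q. gram g q $ i $ j) differentiable (at p)"
    and X: "X differentiable (at p)" and Y: "Y differentiable (at p)"
  shows "frechet_derivative (\<lambda>q. g q (X q) (Y q)) (at p) (Z p)
     = g p (levi_civita g Z X p) (Y p) + g p (X p) (levi_civita g Z Y p)"
proof -
  let ?D = "\<lambda>f. frechet_derivative f (at p)"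
  let ?w = "Z p"
  have dX: "((\<lambda>q. X q $ i) has_derivative (\<lambda>h. ?D X h $ i)) (at p)" for i
    using X frechet_derivative_works bounded_linear.has_derivative [OF bounded_linear_vec_nth] by blast
  have dY: "((\<lambda>q. Y q $ i) has_derivative (\<lambda>h. ?D Y h $ i)) (at p)" for i
    using Y frechet_derivative_works bounded_linear.has_derivative [OF bounded_linear_vec_nth] by blast
  have dG: "((\<lambda>q. gram g q $ i $ j) has_derivative ?D (\<lambda>q. gram g q $ i $ j)) (at p)" for i j
    using smooth frechet_derivative_works by blast
  have "((\<lambda>q. \<Sum>i\<in>UNIV. \<Sum>j\<in>UNIV. gram g q $ i $ j * X q $ i * Y q $ j) has_derivative
      (\<lambda>h. \<Sum>i\<in>UNIV. \<Sum>j\<in>UNIV. gram g p $ i $ j * X p $ i * ?D Y h $ j +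
          (gram g p $ i $ j * ?D X h $ i + ?D (\<lambda>q. gram g q $ i $ j) h * X p $ i) * Y p $ j)) (at p)"
    by (intro has_derivative_sum has_derivative_mult dX dY dG)
  then have "((\<lambda>q. g q (X q) (Y q)) has_derivative
      (\<lambda>h. \<Sum>i\<in>UNIV. \<Sum>j\<in>UNIV. gram g p $ i $ j * X p $ i * ?D Y h $ j +
          (gram g p $ i $ j * ?D X h $ i + ?D (\<lambda>q. gram g q $ i $ j) h * X p $ i) * Y p $ j)) (at p)"
    by (simp add: metric_eq_gram [where g=g, OF bil])
  then have "?D (\<lambda>q. g q (X q) (Y q)) ?w = (\<Sum>i\<in>UNIV. \<Sum>j\<in>UNIV. gram g p $ i $ j * X p $ i * ?D Y ?w $ j +
          (gram g p $ i $ j * ?D X ?w $ i + ?D (\<lambda>q. gram g q $ i $ j) ?w * X p $ i) * Y p $ j)"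
    by (simp add: frechet_derivative_at [symmetric])
  also have "\<dots> = g p (X p) (?D Y ?w) + g p (?D X ?w) (Y p)
       + (\<Sum>i\<in>UNIV. \<Sum>j\<in>UNIV. ?D (\<lambda>q. gram g q $ i $ j) ?w * X p $ i * Y p $ j)"
    by (simp add: metric_eq_gram [where g=g, OF bil] sum.distrib distrib_right add.assoc)
  also have "(\<Sum>i\<in>UNIV. \<Sum>j\<in>UNIV. ?D (\<lambda>q. gram g q $ i $ j) ?w * X p $ i * Y p $ j)
      = g p (christoffel_form g p ?w (X p)) (Y p) + g p (X p) (christoffel_form g p ?w (Y p))"
  proof -
    define P where "P k i j = partial k (\<lambda>q. gram g q $ i $ j) p" for k i j
    have Ps: "P k i j = P k j i" for k i j
      using sym by (simp add: P_def gram_def)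
    let ?S = "\<lambda>f. (\<Sum>k\<in>UNIV. \<Sum>i\<in>UNIV. \<Sum>j\<in>UNIV. f k i j * ?w $ k * X p $ i * Y p $ j)"
    have 1: "g p (christoffel_form g p ?w (X p)) (Y p) = 1/2 * ?S (\<lambda>k i j. P k i j + P i k j - P j k i)"
      by (simp add: gram_christoffel_form [OF sym bil inv] P_def)
    have "g p (X p) (christoffel_form g p ?w (Y p)) =
        1/2 * (\<Sum>k\<in>UNIV. \<Sum>i\<in>UNIV. \<Sum>j\<in>UNIV. (P k i j + P i k j - P j k i) * ?w $ k * Y p $ i * X p $ j)"
      by (subst sym) (simp add: gram_christoffel_form [OF sym bil inv] P_def)
    also have "\<dots> = 1/2 * ?S (\<lambda>k j i. P k i j + P i k j - P j k i)"
    proof -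
      have "(\<Sum>i\<in>UNIV. \<Sum>j\<in>UNIV. (P k i j + P i k j - P j k i) * ?w $ k * Y p $ i * X p $ j)
          = (\<Sum>i\<in>UNIV. \<Sum>j\<in>UNIV. (P k j i + P j k i - P i k j) * ?w $ k * X p $ i * Y p $ j)" for k
        by (subst sum.swap) (simp add: mult_ac)
      then show ?thesis by simp
    qed
    finally have 2: "g p (X p) (christoffel_form g p ?w (Y p)) = 1/2 * ?S (\<lambda>k i j. P k i j + P j k i - P i k j)"
      by (simp add: Ps)
    have "1/2 * ?S (\<lambda>k i j. P k i j + P i k j - P j k i) + 1/2 * ?S (\<lambda>k i j. P k i j + P j k i - P i k j)
        = ?S P"
      unfolding sum_distrib_left sum.distrib [symmetric]
      by (intro sum.cong refl) (simp add: field_simps)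
    also have "\<dots> = (\<Sum>i\<in>UNIV. \<Sum>k\<in>UNIV. \<Sum>j\<in>UNIV. P k i j * ?w $ k * X p $ i * Y p $ j)"
      by (rule sum.swap)
    also have "\<dots> = (\<Sum>i\<in>UNIV. \<Sum>j\<in>UNIV. \<Sum>k\<in>UNIV. P k i j * ?w $ k * X p $ i * Y p $ j)"
      by (intro sum.cong refl sum.swap)
    also have "\<dots> = (\<Sum>i\<in>UNIV. \<Sum>j\<in>UNIV. ?D (\<lambda>q. gram g q $ i $ j) ?w * X p $ i * Y p $ j)"
      by (simp add: partial_expand [OF smooth] P_def sum_distrib_left sum_distrib_right mult_ac)
    finally show ?thesis using 1 2 by simp
  qed
  finally show ?thesis
    by (simp add: levi_civita_def bilinear_ladd [OF bil] bilinear_radd [OF bil])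
qed

lemma cov_along_extension:
  assumes "\<gamma> differentiable (at t)" "Y differentiable (at (\<gamma> t))"
    and "X (\<gamma> t) = velocity \<gamma> t"
  shows "cov_along g \<gamma> (\<lambda>s. Y (\<gamma> s)) t = levi_civita g X Y (\<gamma> t)"
proof -
  have "(\<gamma> has_derivative (\<lambda>h. h *\<^sub>R velocity \<gamma> t)) (at t)"
    using assms(1) vector_derivative_works has_vector_derivative_def by blast
  moreover have "(Y has_derivative frechet_derivative Y (at (\<gamma> t))) (at (\<gamma> t))"
    using assms(2) frechet_derivative_works by blast
  ultimately have "((\<lambda>s. Y (\<gamma> s)) has_derivative (\<lambda>h. frechet_derivative Y (at (\<gamma> t)) (h *\<^sub>R velocity \<gamma> t))) (at t)"
    by (rule has_derivative_compose)
  moreover have "linear (frechet_derivative Y (at (\<gamma> t)))"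
    using assms(2) linear_frechet_derivative by blast
  ultimately have "((\<lambda>s. Y (\<gamma> s)) has_vector_derivative frechet_derivative Y (at (\<gamma> t)) (velocity \<gamma> t)) (at t)"
    by (simp add: has_vector_derivative_def linear_cmul)
  then show ?thesis
    by (simp add: cov_along_def levi_civita_def vector_derivative_at assms(3))
qed

lemma heis_metric_sym: "heis_metric p u v = heis_metric p v u"
  by (simp add: heis_metric_def algebra_simps)

lemma heis_metric_bilinear: "bilinear (heis_metric p)"
  unfolding bilinear_def
  by (auto intro!: linearI simp: heis_metric_def algebra_simps add_divide_distrib diff_divide_distrib)

lemma heis_metric_pos: "u \<noteq> 0 \<Longrightarrow> heis_metric p u u > 0"
proof -
  assume "u \<noteq> 0"
  moreover have "u = 0" if "heis_metric p u u = 0"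
  proof -
    have "(u$1)^2 + (u$2)^2 + (u$3 + p$2 / 2 * u$1 - p$1 / 2 * u$2)^2 = 0"
      using that by (simp add: heis_metric_def power2_eq_square)
    then have "u$1 = 0" "u$2 = 0" "u$3 + p$2 / 2 * u$1 - p$1 / 2 * u$2 = 0"
      by (smt (verit) zero_le_power2 power2_eq_iff_nonneg zero_eq_power2)+
    then show "u = 0" by (simp add: vec_eq_iff forall_3)
  qed
  moreover have "heis_metric p u u \<ge> 0"
    by (simp add: heis_metric_def)
  ultimately show ?thesis by fastforce
qed

lemma heis_gram_invertible: "invertible (gram heis_metric p)"
  by (simp add: invertible_det_nz det_3 gram_def heis_metric_def axis_def field_simps)

lemma heis_frame_orthonormal:
  "heis_metric p (heis_frame p $ i) (heis_frame p $ j) = (if i = j then 1 else 0)"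
  using exhaust_3 [of i] exhaust_3 [of j]
  by (auto simp: heis_metric_def heis_frame_def)

lemma heis_comp_expansion: "(\<Sum>i\<in>UNIV. heis_comp p u $ i *\<^sub>R heis_frame p $ i) = u"
  by (simp add: vec_eq_iff forall_3 sum_3 heis_comp_def heis_metric_def heis_frame_def
      algebra_simps add_divide_distrib diff_divide_distrib)

lemma heis_mult_derivative:
  "(heis_mult a has_derivative
     (\<lambda>v. v + (1/2 * a$1 * v$2 - 1/2 * a$2 * v$1) *\<^sub>R axis 3 1)) (at p)"
proof -
  have "heis_mult a = (\<lambda>q. a + q + (1/2 * a$1 * q$2 - 1/2 * a$2 * q$1) *\<^sub>R axis 3 1)"
    by (rule ext) (simp add: vec_eq_iff forall_3 heis_mult_def axis_def)
  then show ?thesis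
    by (auto intro!: derivative_eq_intros bounded_linear.has_derivative [OF bounded_linear_vec_nth])
qed

lemma heis_frame_left_invariant:
  "frechet_derivative (heis_mult a) (at p) (heis_frame p $ i) = heis_frame (heis_mult a p) $ i"
  using exhaust_3 [of i]
  by (auto simp: frechet_derivative_at [OF heis_mult_derivative, symmetric] heis_frame_def
      heis_mult_def vec_eq_iff forall_3 axis_def algebra_simps)

lemma heis_metric_left_invariant:
  "heis_metric (heis_mult a p) (frechet_derivative (heis_mult a) (at p) u)
     (frechet_derivative (heis_mult a) (at p) v) = heis_metric p u v"
  by (simp add: frechet_derivative_at [OF heis_mult_derivative, symmetric]
      heis_metric_def heis_mult_def axis_def field_simps)

end

theory Submission
  imports Defs
begin

text \<open>
  In the left-invariant frame the covariant derivative along a curve with velocity \<open>T\<close> is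
  \<open>w \<mapsto> w' + \<omega>(T) \<times> w\<close> with \<open>\<omega>(T) = (T\<^sub>1, T\<^sub>2, -T\<^sub>3)/2\<close>, and the curvature is
  \<open>R(u,v)w = A(u \<times> v) \<times> w\<close> with \<open>A = diag(1/4, 1/4, -3/4)\<close>.  Since \<open>R(T, \<cdot>)T\<close> is orthogonal to \<open>T\<close>,
  the tangential component of the bitension field is \<open>-3/2 (k\<^sup>2)'\<close>; hence a biharmonic curve has constant
  \<open>k\<close>, and \<open>N\<close>, \<open>B\<close>, \<open>\<tau>\<close> are defined everywhere as soon as the curve is not a geodesic.  For
  constant \<open>k \<noteq> 0\<close> the components of the bitension field along \<open>N\<close> and \<open>B\<close> are
  \<open>k (1/4 - B\<^sub>3\<^sup>2 - k\<^sup>2 - \<tau>\<^sup>2)\<close> and \<open>k (N\<^sub>3 B\<^sub>3 - \<tau>')\<close>.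
\<close>

section \<open>Connection and curvature in the left-invariant frame\<close>

text \<open>Inverse of \<open>heis_comp p\<close>: the coordinates of the tangent vector at
  \<open>p\<close> with frame components \<open>a\<close>.\<close>

definition heis_vec :: "real^3 \<Rightarrow> real^3 \<Rightarrow> real^3" where
  "heis_vec p a = a + (p$1 / 2 * a$2 - p$2 / 2 * a$1) *\<^sub>R axis 3 1"

text \<open>The connection form: \<open>\<nabla>\<^sub>u w = heis_omega u \<times> w\<close> for left-invariant \<open>w\<close>, in frame components.\<close>

definition heis_omega :: "real^3 \<Rightarrow> real^3" where
  "heis_omega a = vector [a$1 / 2, a$2 / 2, - a$3 / 2]"

text \<open>The curvature operator on bivectors, identified with vectors by the cross product.\<close>

definition heis_curv :: "real^3 \<Rightarrow> real^3" where
  "heis_curv b = (1/4) *\<^sub>R b - b$3 *\<^sub>R axis 3 1"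

lemma vec3_eqI:
  fixes u v :: "real^3"
  assumes "u$1 = v$1" "u$2 = v$2" "u$3 = v$3"
  shows "u = v"
  using assms by (simp add: vec_eq_iff forall_3)

lemma heis_comp_nth [simp]:
  "heis_comp p u $ 1 = u$1"
  "heis_comp p u $ 2 = u$2"
  "heis_comp p u $ 3 = u$3 + p$2 / 2 * u$1 - p$1 / 2 * u$2"
  by (simp_all add: heis_comp_def heis_metric_def heis_frame_def)

lemma heis_vec_nth [simp]:
  "heis_vec p a $ 1 = a$1"
  "heis_vec p a $ 2 = a$2"
  "heis_vec p a $ 3 = a$3 + p$1 / 2 * a$2 - p$2 / 2 * a$1"
  by (simp_all add: heis_vec_def axis_def)

lemma heis_comp_vec [simp]: "heis_comp p (heis_vec p a) = a"
  by (rule vec3_eqI) (simp_all add: field_simps)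

lemma heis_vec_comp [simp]: "heis_vec p (heis_comp p u) = u"
  by (rule vec3_eqI) (simp_all add: field_simps)

lemma heis_vec_frame_sum: "(\<Sum>i\<in>UNIV. a$i *\<^sub>R heis_frame p $ i) = heis_vec p a"
  by (rule vec3_eqI) (simp_all add: sum_3 heis_frame_def field_simps)

lemma heis_comp_inject: "heis_comp p u = heis_comp p v \<longleftrightarrow> u = v"
  by (metis heis_vec_comp)

lemma heis_comp_linear:
  "heis_comp p (u + v) = heis_comp p u + heis_comp p v"
  "heis_comp p (u - v) = heis_comp p u - heis_comp p v"
  "heis_comp p (c *\<^sub>R u) = c *\<^sub>R heis_comp p u"
  "heis_comp p (- u) = - heis_comp p u"
  "heis_comp p 0 = 0"
  by (rule vec3_eqI; simp add: field_simps)+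

lemma heis_metric_comp: "heis_metric p u v = heis_comp p u \<bullet> heis_comp p v"
  by (simp add: inner_vec_def sum_3 heis_metric_def)

lemma heis_comp_cross: "heis_comp p (heis_cross p u v) = cross3 (heis_comp p u) (heis_comp p v)"
  by (simp add: heis_cross_def heis_vec_frame_sum)

text \<open>
  The Gram matrix is \<open>diag(1,1,0) + \<theta> \<theta>\<^sup>T\<close> for the contact form \<open>\<theta> = dz + y/2 dx - x/2 dy\<close>, and
  \<open>\<theta>'\<close> is the \<open>k\<close>-th partial derivative of \<open>\<theta>\<close>.
\<close>

lemma partial_heis_gram:
  "partial k (\<lambda>q. gram heis_metric q $ i $ j) p =
     (let \<theta> = (\<lambda>u::real^3. u$3 + p$2 / 2 * u$1 - p$1 / 2 * u$2);
          \<theta>' = (\<lambda>u::real^3. axis k 1 $ 2 / 2 * u$1 - axis k 1 $ 1 / 2 * u$2)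
      in \<theta> (axis i 1) * \<theta>' (axis j 1) + \<theta>' (axis i 1) * \<theta> (axis j 1))"
proof -
  have "((\<lambda>q. gram heis_metric q $ i $ j) has_derivative
     (\<lambda>h. let \<theta> = (\<lambda>u::real^3. u$3 + p$2 / 2 * u$1 - p$1 / 2 * u$2);
          \<theta>' = (\<lambda>u::real^3. h $ 2 / 2 * u$1 - h $ 1 / 2 * u$2)
      in \<theta> (axis i 1) * \<theta>' (axis j 1) + \<theta>' (axis i 1) * \<theta> (axis j 1))) (at p)"
    unfolding gram_def heis_metric_def Let_def
    by (auto intro!: derivative_eq_intros
          bounded_linear.has_derivative [OF bounded_linear_vec_nth])
  then show ?thesis
    unfolding partial_def by (simp add: frechet_derivative_at [symmetric])
qed

text \<open>Pairing with the orthonormal frame through \<open>gram_christoffel_form\<close> avoids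
  inverting the Gram matrix. The third component vanishes because the derivative of \<theta> is
  antisymmetric in direction and argument.\<close>

lemma heis_comp_christoffel:
  "heis_comp p (christoffel_form heis_metric p u v) =
     vector [1/2 * (u$2 * heis_comp p v $ 3 + heis_comp p u $ 3 * v$2),
             - 1/2 * (u$1 * heis_comp p v $ 3 + heis_comp p u $ 3 * v$1), 0]"
proof -
  have "heis_comp p (christoffel_form heis_metric p u v) $ l =
    heis_metric p (christoffel_form heis_metric p u v) (heis_frame p $ l)" for l
    by (simp add: heis_comp_def)
  note * = this [unfolded gram_christoffel_form [where g=heis_metric, OF heis_metric_sym heis_metric_bilinear heis_gram_invertible]]
  show ?thesis
    by (rule vec3_eqI; unfold *)
       (simp_all add: sum_3 partial_heis_gram axis_def heis_frame_def field_simps)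
qed

section \<open>Derivative of the Christoffel form and the curvature tensor\<close>

lemma christoffel_form_heis:
  "christoffel_form heis_metric p u v =
     heis_vec p (vector [1/2 * (u$2 * heis_comp p v $ 3 + heis_comp p u $ 3 * v$2),
             - 1/2 * (u$1 * heis_comp p v $ 3 + heis_comp p u $ 3 * v$1), 0])"
  by (simp only: heis_comp_christoffel [symmetric] heis_vec_comp)

text \<open>\<open>c1\<close>, \<open>c2\<close> are frame components of the form at
  \<open>p\<close>; \<open>du\<close>, \<open>dv\<close> are the variations of the third frame
  components of \<open>u\<close>, \<open>v\<close>. The terms with \<open>c1\<close>,
  \<open>c2\<close> in the last entry come from the moving base point of
  \<open>heis_vec\<close>.\<close>

lemma christoffel_form_heis_derivative:
  "((\<lambda>q. christoffel_form heis_metric q u v) has_derivative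
     (\<lambda>h. let c1 = 1/2 * (u$2 * heis_comp p v $ 3 + heis_comp p u $ 3 * v$2);
              c2 = - 1/2 * (u$1 * heis_comp p v $ 3 + heis_comp p u $ 3 * v$1);
              du = h$2 / 2 * u$1 - h$1 / 2 * u$2;
              dv = h$2 / 2 * v$1 - h$1 / 2 * v$2;
              d1 = 1/2 * (u$2 * dv + du * v$2);
              d2 = - 1/2 * (u$1 * dv + du * v$1)
       in vector [d1, d2, p$1 / 2 * d2 - p$2 / 2 * d1 + h$1 / 2 * c2 - h$2 / 2 * c1])) (at p)"
proof -
  \<comment> \<open>\<open>a w q\<close> is \<theta> at \<open>q\<close> applied to
    \<open>w\<close>, the third frame component of \<open>w\<close>, written as a polynomial in
    \<open>q\<close>.\<close>
  define a where "a w q = w$3 + 1/2 * (w$1 * q$2 - w$2 * q$1)" for w q :: "real^3"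
  note nth = bounded_linear.has_derivative [OF bounded_linear_vec_nth has_derivative_ident]
  have a: "(a w has_derivative (\<lambda>h. h$2 / 2 * w$1 - h$1 / 2 * w$2)) (at p)" for w
    unfolding a_def by (rule has_derivative_eq_rhs, (rule derivative_intros nth)+) (simp add: field_simps)
  have eq: "(\<lambda>q. christoffel_form heis_metric q u v) = (\<lambda>q.
     (1/2 * (u$2 * a v q + a u q * v$2)) *\<^sub>R axis 1 1
    + (- 1/2 * (u$1 * a v q + a u q * v$1)) *\<^sub>R axis 2 1
    + (1/2 * (q$1 * (- 1/2 * (u$1 * a v q + a u q * v$1))
      - q$2 * (1/2 * (u$2 * a v q + a u q * v$2)))) *\<^sub>R axis 3 1)"
    by (rule ext, rule vec3_eqI) (simp_all add: christoffel_form_heis axis_def a_def field_simps)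
  show ?thesis
    unfolding eq
    by (rule has_derivative_eq_rhs, (rule derivative_intros nth a)+, rule ext, rule vec3_eqI)
       (simp_all add: Let_def axis_def a_def algebra_simps add_divide_distrib diff_divide_distrib)
qed

lemma christoffel_form_0: "christoffel_form g p 0 v = 0"
  by (simp add: christoffel_form_def vec_eq_iff)

text \<open>Passing to frame components at \<open>p\<close> cancels the terms
  \<open>p$1 / 2 * d2 - p$2 / 2 * d1\<close> of the derivative.\<close>

lemma heis_comp_christoffel_derivative:
  "heis_comp p (frechet_derivative (\<lambda>q. christoffel_form heis_metric q u v) (at p) h) =
     (let c = heis_comp p (christoffel_form heis_metric p u v);
          du = h$2 / 2 * u$1 - h$1 / 2 * u$2;
          dv = h$2 / 2 * v$1 - h$1 / 2 * v$2
      in vector [1/2 * (u$2 * dv + du * v$2), - 1/2 * (u$1 * dv + du * v$1), h$1 / 2 * c$2 - h$2 / 2 * c$1])"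
  unfolding frechet_derivative_at [OF christoffel_form_heis_derivative, symmetric] heis_comp_christoffel
  by (rule vec3_eqI) (simp_all add: Let_def)

lemma heis_comp_riemann:
  "heis_comp p (riemann_at heis_metric p u v w) =
     cross3 (heis_curv (cross3 (heis_comp p u) (heis_comp p v))) (heis_comp p w)"
proof -
  have lc: "levi_civita heis_metric (\<lambda>_. a) (\<lambda>_. b) = (\<lambda>q. christoffel_form heis_metric q a b)" for a b
    by (rule ext) (simp add: levi_civita_def)
  \<comment> \<open>Fields with constant coordinates commute, so the bracket term drops out.\<close>
  have R: "riemann_at heis_metric p u v w =
     - (frechet_derivative (\<lambda>q. christoffel_form heis_metric q v w) (at p) u
        + christoffel_form heis_metric p u (christoffel_form heis_metric p v w))
     + (frechet_derivative (\<lambda>q. christoffel_form heis_metric q u w) (at p) v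
        + christoffel_form heis_metric p v (christoffel_form heis_metric p u w))"
    unfolding riemann_at_def riemann_def lc
    by (simp add: lie_bracket_def levi_civita_def christoffel_form_0)
  \<comment> \<open>In frame components the coordinates of \<open>p\<close> cancel, as left
    invariance predicts, and a polynomial identity in \<open>a\<close>, \<open>b\<close>,
    \<open>c\<close> remains.\<close>
  define a b c where "a = heis_comp p u" "b = heis_comp p v" "c = heis_comp p w"
  then have uvw: "u = heis_vec p a" "v = heis_vec p b" "w = heis_vec p c"
    by simp_all
  show ?thesis
    unfolding R heis_comp_linear heis_comp_christoffel_derivative Let_def
    unfolding christoffel_form_heis
    unfolding uvw heis_comp_vec heis_vec_nth vector_3
    by (rule vec3_eqI) (simp_all add: cross_components heis_curv_def axis_def field_simps)
qed

text \<open>The derivative of the frame along the curve and the Christoffel term add up to the cross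
  product with the connection form. Agreement of \<open>V\<close> with \<open>w\<close> on an open
  set suffices, derivatives being local.\<close>

lemma heis_cov_along_comp:
  assumes \<gamma>: "\<gamma> differentiable (at t)" and I: "open I" "t \<in> I"
    and V: "\<And>s. s \<in> I \<Longrightarrow> heis_comp (\<gamma> s) (V s) = w s"
    and w: "(w has_vector_derivative w') (at t)"
  shows "heis_comp (\<gamma> t) (cov_along heis_metric \<gamma> V t) =
     w' + cross3 (heis_omega (heis_comp (\<gamma> t) (velocity \<gamma> t))) (w t)"
proof -
  have g: "((\<lambda>s. \<gamma> s $ i) has_vector_derivative velocity \<gamma> t $ i) (at t)" for i
    using \<gamma> bounded_linear.has_vector_derivative [OF bounded_linear_vec_nth] vector_derivative_works
    by blast
  have w2: "((\<lambda>s. w s $ i) has_vector_derivative w' $ i) (at t)" for i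
    using w bounded_linear.has_vector_derivative [OF bounded_linear_vec_nth] by blast
  have "((\<lambda>s. heis_vec (\<gamma> s) (w s)) has_vector_derivative
     w' + (\<gamma> t $ 1 / 2 * w' $ 2 + velocity \<gamma> t $ 1 / 2 * w t $ 2
        - (\<gamma> t $ 2 / 2 * w' $ 1 + velocity \<gamma> t $ 2 / 2 * w t $ 1)) *\<^sub>R axis 3 1) (at t)"
    unfolding heis_vec_def
    by (rule derivative_eq_intros bounded_linear.has_vector_derivative [OF bounded_linear_scaleR_left] g w w2 refl)+
  moreover have "heis_vec (\<gamma> s) (w s) = V s" if "s \<in> I" for s
    using V [OF that] by (metis heis_vec_comp)
  ultimately have "(V has_vector_derivative
     w' + (\<gamma> t $ 1 / 2 * w' $ 2 + velocity \<gamma> t $ 1 / 2 * w t $ 2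
        - (\<gamma> t $ 2 / 2 * w' $ 1 + velocity \<gamma> t $ 2 / 2 * w t $ 1)) *\<^sub>R axis 3 1) (at t)"
    using I has_vector_derivative_transform_within_open by blast
  then show ?thesis
    unfolding cov_along_def
    by (intro vec3_eqI)
       (simp_all add: vector_derivative_at heis_comp_linear heis_comp_christoffel V [OF I(2), symmetric]
          cross_components heis_omega_def axis_def field_simps)
qed

section \<open>Smooth functions of one real variable\<close>

lemma bounded_bilinear_cross3: "bounded_bilinear cross3"
  using bilinear_cross bilinear_conv_bounded_bilinear by blast

text \<open>For \<open>n = 0\<close> the predicate is vacuous; not even continuity is required.\<close>

primrec times_differentiable_on :: "nat \<Rightarrow> real set \<Rightarrow> (real \<Rightarrow> 'a::real_normed_vector) \<Rightarrow> bool" where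
  "times_differentiable_on 0 I f \<longleftrightarrow> True"
| "times_differentiable_on (Suc n) I f \<longleftrightarrow>
     (\<exists>f'. (\<forall>t\<in>I. (f has_vector_derivative f' t) (at t)) \<and> times_differentiable_on n I f')"

lemma times_differentiable_on_Suc_D:
  "times_differentiable_on (Suc n) I f \<Longrightarrow> times_differentiable_on n I f"
  by (induction n arbitrary: f) (simp, metis times_differentiable_on.simps(2))

lemma times_differentiable_on_const: "times_differentiable_on n I (\<lambda>t. c)"
proof (induction n arbitrary: c)
  case (Suc n)
  then show ?case by (auto intro!: exI [of _ "\<lambda>t. 0"])
qed simp

lemma times_differentiable_on_add:
  assumes "times_differentiable_on n I f" "times_differentiable_on n I g"
  shows "times_differentiable_on n I (\<lambda>t. f t + g t)"
  using assms
proof (induction n arbitrary: f g)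
  case (Suc n)
  then obtain f' g' where
    "\<forall>t\<in>I. (f has_vector_derivative f' t) (at t)" "times_differentiable_on n I f'"
    "\<forall>t\<in>I. (g has_vector_derivative g' t) (at t)" "times_differentiable_on n I g'"
    by auto
  then show ?case
    using Suc.IH [of f' g'] by (auto intro!: exI [of _ "\<lambda>t. f' t + g' t"] derivative_intros)
qed simp

lemma times_differentiable_on_bounded_linear:
  assumes "bounded_linear h" "times_differentiable_on n I f"
  shows "times_differentiable_on n I (\<lambda>t. h (f t))"
  using assms(2)
proof (induction n arbitrary: f)
  case (Suc n)
  then obtain f' where
    "\<forall>t\<in>I. (f has_vector_derivative f' t) (at t)" "times_differentiable_on n I f'"
    by auto
  then show ?case
    using Suc.IH [of f'] bounded_linear.has_vector_derivative [OF assms(1)]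
    by (auto intro!: exI [of _ "\<lambda>t. h (f' t)"])
qed simp

lemma times_differentiable_on_bounded_bilinear:
  assumes "bounded_bilinear h" "times_differentiable_on n I f" "times_differentiable_on n I g"
  shows "times_differentiable_on n I (\<lambda>t. h (f t) (g t))"
  using assms(2,3)
proof (induction n arbitrary: f g)
  case (Suc n)
  then obtain f' g' where
    "\<forall>t\<in>I. (f has_vector_derivative f' t) (at t)" "times_differentiable_on n I f'"
    "\<forall>t\<in>I. (g has_vector_derivative g' t) (at t)" "times_differentiable_on n I g'"
    by auto
  \<comment> \<open>The product rule pairs \<open>f\<close> itself with \<open>g'\<close> and
    \<open>f'\<close> with \<open>g\<close>, so both functions are needed at the lower order
    too.\<close>
  moreover have "times_differentiable_on n I f" "times_differentiable_on n I g"
    using Suc.prems times_differentiable_on_Suc_D by blast+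
  ultimately show ?case
    using Suc.IH [of f g'] Suc.IH [of f' g] bounded_bilinear.has_vector_derivative [OF assms(1)]
    by (auto intro!: exI [of _ "\<lambda>t. h (f t) (g' t) + h (f' t) (g t)"] times_differentiable_on_add)
qed simp

text \<open>The derivative witness of \<open>f\<close> serves for \<open>g\<close> unchanged, so a
  case distinction replaces induction.\<close>

lemma times_differentiable_on_cong:
  assumes "open I" "\<And>t. t \<in> I \<Longrightarrow> f t = g t" "times_differentiable_on n I f"
  shows "times_differentiable_on n I g"
  using assms
  by (cases n) (auto intro: has_vector_derivative_transform_within_open)

lemma times_differentiable_on_vector_derivative:
  assumes "open I" "times_differentiable_on (Suc n) I f"
  shows "times_differentiable_on n I (\<lambda>t. vector_derivative f (at t))"
proof -
  obtain f' where f': "\<forall>t\<in>I. (f has_vector_derivative f' t) (at t)" "times_differentiable_on n I f'"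
    using assms(2) by auto
  show ?thesis
    by (rule times_differentiable_on_cong [OF assms(1) _ f'(2)])
       (use f'(1) in \<open>auto simp: vector_derivative_at\<close>)
qed

text \<open>Differentiation costs \<open>times_differentiable_on\<close> one order; quantified over
  all orders, the property is stable under it.\<close>

definition smooth_on :: "real set \<Rightarrow> (real \<Rightarrow> 'a::real_normed_vector) \<Rightarrow> bool" where
  "smooth_on I f \<longleftrightarrow> (\<forall>n. times_differentiable_on n I f)"

lemma smooth_on_const: "smooth_on I (\<lambda>t. c)"
  by (simp add: smooth_on_def times_differentiable_on_const)

lemma smooth_on_add: "smooth_on I f \<Longrightarrow> smooth_on I g \<Longrightarrow> smooth_on I (\<lambda>t. f t + g t)"
  by (simp add: smooth_on_def times_differentiable_on_add)

lemma smooth_on_bounded_linear: "bounded_linear h \<Longrightarrow> smooth_on I f \<Longrightarrow> smooth_on I (\<lambda>t. h (f t))"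
  by (simp add: smooth_on_def times_differentiable_on_bounded_linear)

lemma smooth_on_bounded_bilinear:
  "bounded_bilinear h \<Longrightarrow> smooth_on I f \<Longrightarrow> smooth_on I g \<Longrightarrow> smooth_on I (\<lambda>t. h (f t) (g t))"
  by (simp add: smooth_on_def times_differentiable_on_bounded_bilinear)

lemma smooth_on_diff:
  assumes "smooth_on I f" "smooth_on I g"
  shows "smooth_on I (\<lambda>t. f t - g t)"
  using smooth_on_add [OF assms(1) smooth_on_bounded_linear [OF bounded_linear_minus [OF bounded_linear_ident] assms(2)]]
  by simp

lemma smooth_on_mult:
  fixes f g :: "real \<Rightarrow> 'a::real_normed_algebra"
  shows "smooth_on I f \<Longrightarrow> smooth_on I g \<Longrightarrow> smooth_on I (\<lambda>t. f t * g t)"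
  by (rule smooth_on_bounded_bilinear [OF bounded_bilinear_mult])

lemmas smooth_on_scaleR = smooth_on_bounded_bilinear [OF bounded_bilinear_scaleR]
lemmas smooth_on_cross3 = smooth_on_bounded_bilinear [OF bounded_bilinear_cross3]
lemmas smooth_on_vec_nth = smooth_on_bounded_linear [OF bounded_linear_vec_nth]

lemma smooth_on_vector_derivative:
  "open I \<Longrightarrow> smooth_on I f \<Longrightarrow> smooth_on I (\<lambda>t. vector_derivative f (at t))"
  by (simp add: smooth_on_def times_differentiable_on_vector_derivative del: times_differentiable_on.simps)

lemma smooth_on_has_vector_derivative:
  assumes "smooth_on I f" "t \<in> I"
  shows "(f has_vector_derivative vector_derivative f (at t)) (at t)"
  using assms(1) [unfolded smooth_on_def, rule_format, of 1] assms(2)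
  by (auto simp: vector_derivative_at)

lemma smooth_curve_on_imp_smooth_on:
  assumes "smooth_curve_on I \<gamma>"
  shows "smooth_on I \<gamma>"
proof -
  \<comment> \<open>All iterates are treated together, because the derivative of the
    \<open>m\<close>-th is the next one.\<close>
  have "times_differentiable_on n I ((velocity ^^ m) \<gamma>)" for n m
  proof (induction n arbitrary: m)
    case (Suc n)
    show ?case
      using assms Suc.IH [of "Suc m"]
      by (auto intro!: exI [of _ "(velocity ^^ Suc m) \<gamma>"]
            simp: smooth_curve_on_def vector_derivative_works)
  qed simp
  from this [of _ 0] show ?thesis
    by (simp add: smooth_on_def)
qed

lemma smooth_on_heis_omega: "smooth_on I f \<Longrightarrow> smooth_on I (\<lambda>t. heis_omega (f t))"
proof (rule smooth_on_bounded_linear [where h = heis_omega])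
  have "linear heis_omega"
    by (rule linearI; rule vec3_eqI) (simp_all add: heis_omega_def field_simps)
  then show "bounded_linear heis_omega"
    by (simp add: linear_conv_bounded_linear)
qed

lemma smooth_on_heis_comp:
  assumes "smooth_on I \<gamma>" "smooth_on I f"
  shows "smooth_on I (\<lambda>t. heis_comp (\<gamma> t) (f t))"
proof -
  have eq: "heis_comp p u = u + ((1/2) * (p$2 * u$1 - p$1 * u$2)) *\<^sub>R axis 3 1" for p u
    by (rule vec3_eqI) (simp_all add: axis_def field_simps)
  show ?thesis
    unfolding eq by (intro smooth_on_add smooth_on_scaleR smooth_on_mult smooth_on_diff smooth_on_const
       smooth_on_vec_nth assms)
qed

section \<open>Covariant differentiation in the frame\<close>

text \<open>By \<open>heis_cov_along_comp\<close>, the covariant derivative along a curve whose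
  velocity has frame components \<open>T\<close>.\<close>

definition frame_cov :: "(real \<Rightarrow> real^3) \<Rightarrow> (real \<Rightarrow> real^3) \<Rightarrow> real \<Rightarrow> real^3" where
  "frame_cov T w t = vector_derivative w (at t) + cross3 (heis_omega (T t)) (w t)"

lemma smooth_on_frame_cov:
  "open I \<Longrightarrow> smooth_on I T \<Longrightarrow> smooth_on I w \<Longrightarrow> smooth_on I (frame_cov T w)"
  unfolding frame_cov_def [abs_def]
  by (intro smooth_on_add smooth_on_cross3 smooth_on_heis_omega smooth_on_vector_derivative)

lemma frame_cov_scaleR:
  assumes "smooth_on I w" "t \<in> I"
  shows "frame_cov T (\<lambda>s. c *\<^sub>R w s) t = c *\<^sub>R frame_cov T w t"
proof -
  have "((\<lambda>s. c *\<^sub>R w s) has_vector_derivative c *\<^sub>R vector_derivative w (at t)) (at t)"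
    using bounded_linear.has_vector_derivative [OF bounded_linear_scaleR_right]
      smooth_on_has_vector_derivative [OF assms] by blast
  then show ?thesis
    by (simp add: frame_cov_def vector_derivative_at cross_mult_right scaleR_right_distrib)
qed

text \<open>By the Jacobi identity, the cross product with \<open>heis_omega (T t)\<close> acts as a
  derivation of the cross product.\<close>

lemma frame_cov_cross3:
  assumes "smooth_on I v" "smooth_on I w" "t \<in> I"
  shows "frame_cov T (\<lambda>s. cross3 (v s) (w s)) t =
    cross3 (frame_cov T v t) (w t) + cross3 (v t) (frame_cov T w t)"
proof -
  have "((\<lambda>s. cross3 (v s) (w s)) has_vector_derivative
      cross3 (v t) (vector_derivative w (at t)) + cross3 (vector_derivative v (at t)) (w t)) (at t)"
    using bounded_bilinear.has_vector_derivative [OF bounded_bilinear_cross3]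
      smooth_on_has_vector_derivative assms by blast
  then show ?thesis
    using Jacobi [of "heis_omega (T t)" "v t" "w t"]
      cross_skew [of "v t" "cross3 (w t) (heis_omega (T t))"] cross_skew [of "w t" "heis_omega (T t)"]
      cross_skew [of "w t" "cross3 (heis_omega (T t)) (v t)"]
    by (simp add: frame_cov_def vector_derivative_at cross_add_left cross_add_right algebra_simps)
qed

text \<open>Metric compatibility: the cross product with a fixed vector is skew-symmetric.\<close>

lemma frame_cov_inner:
  assumes "smooth_on I v" "smooth_on I w" "t \<in> I"
  shows "((\<lambda>s. v s \<bullet> w s) has_real_derivative
    frame_cov T v t \<bullet> w t + v t \<bullet> frame_cov T w t) (at t)"
proof -
  have "((\<lambda>s. v s \<bullet> w s) has_vector_derivative
      v t \<bullet> vector_derivative w (at t) + vector_derivative v (at t) \<bullet> w t) (at t)"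
    using bounded_bilinear.has_vector_derivative [OF bounded_bilinear_inner]
      smooth_on_has_vector_derivative assms by blast
  moreover have "cross3 (heis_omega (T t)) (v t) \<bullet> w t = - (v t \<bullet> cross3 (heis_omega (T t)) (w t))"
    by (metis cross_skew cross_triple inner_commute inner_minus_left)
  ultimately show ?thesis
    by (simp add: has_real_derivative_iff_has_vector_derivative frame_cov_def inner_add_left
        inner_add_right add.commute)
qed

section \<open>Curves parametrized by arc length\<close>

locale unit_speed_heis_curve =
  fixes I :: "real set" and \<gamma> :: "real \<Rightarrow> real^3"
  assumes open_I: "open I" and interval_I: "is_interval I" and nonempty_I: "I \<noteq> {}"
    and smooth_\<gamma>: "smooth_curve_on I \<gamma>"
    and arc_length: "arc_length_param_on heis_metric I \<gamma>"
begin

text \<open>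
  Frame components of the velocity and of its first three covariant derivatives.
\<close>

definition T :: "real \<Rightarrow> real^3" where "T t = heis_comp (\<gamma> t) (velocity \<gamma> t)"
definition P :: "real \<Rightarrow> real^3" where "P = frame_cov T T"
definition Q :: "real \<Rightarrow> real^3" where "Q = frame_cov T P"
definition S :: "real \<Rightarrow> real^3" where "S = frame_cov T Q"

lemma smooth_TPQ: "smooth_on I T" "smooth_on I P" "smooth_on I Q"
proof -
  have \<gamma>: "smooth_on I \<gamma>"
    by (rule smooth_curve_on_imp_smooth_on [OF smooth_\<gamma>])
  show T: "smooth_on I T"
    unfolding T_def [abs_def] by (intro smooth_on_heis_comp smooth_on_vector_derivative open_I \<gamma>)
  show P: "smooth_on I P"
    unfolding P_def by (intro smooth_on_frame_cov open_I T)
  show "smooth_on I Q"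
    unfolding Q_def by (intro smooth_on_frame_cov open_I T P)
qed

text \<open>The conclusion at every point of \<open>I\<close> is the agreement hypothesis for the
  next covariant derivative, so nested ones are evaluated in turn.\<close>

lemma heis_comp_nabla:
  assumes "smooth_on I w" "t \<in> I" "\<And>s. s \<in> I \<Longrightarrow> heis_comp (\<gamma> s) (V s) = w s"
  shows "heis_comp (\<gamma> t) (heis_nabla \<gamma> V t) = frame_cov T w t"
proof -
  have "\<gamma> differentiable (at t)"
    using smooth_\<gamma> \<open>t \<in> I\<close> unfolding smooth_curve_on_def by (metis funpow_0)
  from heis_cov_along_comp [OF this open_I \<open>t \<in> I\<close> assms(3) smooth_on_has_vector_derivative [OF assms(1,2)]]
  show ?thesis
    by (simp add: frame_cov_def T_def)
qed

lemma heis_comp_nabla_T: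
  assumes "t \<in> I"
  shows "heis_comp (\<gamma> t) (heis_nabla \<gamma> (velocity \<gamma>) t) = P t"
    and "heis_comp (\<gamma> t) (heis_nabla \<gamma> (heis_nabla \<gamma> (velocity \<gamma>)) t) = Q t"
    and "heis_comp (\<gamma> t) (heis_nabla \<gamma> (heis_nabla \<gamma> (heis_nabla \<gamma> (velocity \<gamma>))) t) = S t"
proof -
  have 1: "heis_comp (\<gamma> s) (heis_nabla \<gamma> (velocity \<gamma>) s) = P s" if "s \<in> I" for s
    unfolding P_def by (rule heis_comp_nabla [OF smooth_TPQ(1) that]) (simp add: T_def)
  have 2: "heis_comp (\<gamma> s) (heis_nabla \<gamma> (heis_nabla \<gamma> (velocity \<gamma>)) s) = Q s" if "s \<in> I" for s
    unfolding Q_def by (rule heis_comp_nabla [OF smooth_TPQ(2) that 1])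
  have 3: "heis_comp (\<gamma> s) (heis_nabla \<gamma> (heis_nabla \<gamma> (heis_nabla \<gamma> (velocity \<gamma>))) s) = S s" if "s \<in> I" for s
    unfolding S_def by (rule heis_comp_nabla [OF smooth_TPQ(3) that 2])
  from 1 2 3 assms show
    "heis_comp (\<gamma> t) (heis_nabla \<gamma> (velocity \<gamma>) t) = P t"
    "heis_comp (\<gamma> t) (heis_nabla \<gamma> (heis_nabla \<gamma> (velocity \<gamma>)) t) = Q t"
    "heis_comp (\<gamma> t) (heis_nabla \<gamma> (heis_nabla \<gamma> (heis_nabla \<gamma> (velocity \<gamma>))) t) = S t"
    by auto
qed

lemma heis_curvature_eq: "t \<in> I \<Longrightarrow> heis_curvature \<gamma> t = norm (P t)"
  by (simp add: geodesic_curvature_def heis_metric_comp heis_comp_nabla_T norm_eq_sqrt_inner)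

lemma geodesic_on_iff: "geodesic_on heis_metric I \<gamma> \<longleftrightarrow> (\<forall>t\<in>I. P t = 0)"
  unfolding geodesic_on_def
  by (intro ball_cong refl) (metis heis_comp_nabla_T(1) heis_comp_linear(5) heis_comp_inject)

lemma heis_comp_bitension:
  assumes "t \<in> I"
  shows "heis_comp (\<gamma> t) (bitension heis_metric \<gamma> t) = S t + cross3 (heis_curv (cross3 (T t) (P t))) (T t)"
  unfolding bitension_def heis_comp_linear heis_comp_riemann heis_comp_nabla_T [OF assms]
  by (simp add: T_def)

lemma biharmonic_on_iff:
  "biharmonic_on heis_metric I \<gamma> \<longleftrightarrow> (\<forall>t\<in>I. S t + cross3 (heis_curv (cross3 (T t) (P t))) (T t) = 0)"
  unfolding biharmonic_on_def
  by (intro ball_cong refl) (metis heis_comp_bitension heis_comp_linear(5) heis_comp_inject)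

lemma inner_derivatives:
  assumes "t \<in> I"
  shows "((\<lambda>s. T s \<bullet> T s) has_real_derivative 2 * (T t \<bullet> P t)) (at t)"
    and "((\<lambda>s. T s \<bullet> P s) has_real_derivative P t \<bullet> P t + T t \<bullet> Q t) (at t)"
    and "((\<lambda>s. P s \<bullet> P s) has_real_derivative 2 * (P t \<bullet> Q t)) (at t)"
    and "((\<lambda>s. T s \<bullet> Q s) has_real_derivative P t \<bullet> Q t + T t \<bullet> S t) (at t)"
    and "((\<lambda>s. P s \<bullet> Q s) has_real_derivative Q t \<bullet> Q t + P t \<bullet> S t) (at t)"
  using frame_cov_inner [OF smooth_TPQ(1) smooth_TPQ(1) assms, of T]
    frame_cov_inner [OF smooth_TPQ(1) smooth_TPQ(2) assms, of T]
    frame_cov_inner [OF smooth_TPQ(2) smooth_TPQ(2) assms, of T]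
    frame_cov_inner [OF smooth_TPQ(1) smooth_TPQ(3) assms, of T]
    frame_cov_inner [OF smooth_TPQ(2) smooth_TPQ(3) assms, of T]
  by (simp_all add: P_def [symmetric] Q_def [symmetric] S_def [symmetric] inner_commute)

text \<open>Serves to differentiate identities valid on \<open>I\<close>: the relations
  \<open>T_P\<close>, \<open>T_Q\<close>, \<open>T_S\<close>, \<open>P_Q\<close> and
  \<open>P_S\<close> all arise in this way.\<close>

lemma derivative_unique_on:
  assumes "(f has_real_derivative d) (at t)" "(g has_real_derivative d') (at t)"
    and "t \<in> I" "\<And>s. s \<in> I \<Longrightarrow> f s = g s"
  shows "d = d'"
proof -
  have "(g has_real_derivative d) (at t)"
    using has_field_derivative_transform_within_open [OF assms(1) open_I assms(3)] assms(4) by blast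
  then show ?thesis
    using assms(2) by (rule DERIV_unique)
qed

lemma T_T: "t \<in> I \<Longrightarrow> T t \<bullet> T t = 1"
  using arc_length by (simp add: arc_length_param_on_def heis_metric_comp T_def)

lemma T_P: "t \<in> I \<Longrightarrow> T t \<bullet> P t = 0"
  using derivative_unique_on [OF inner_derivatives(1) DERIV_const, of t 1] T_T by simp

lemma T_Q: "t \<in> I \<Longrightarrow> T t \<bullet> Q t = - (P t \<bullet> P t)"
  using derivative_unique_on [OF inner_derivatives(2) DERIV_const, of t 0] T_P by simp

lemma T_S: "t \<in> I \<Longrightarrow> T t \<bullet> S t = - 3 * (P t \<bullet> Q t)"
  using derivative_unique_on [OF inner_derivatives(4) DERIV_minus [OF inner_derivatives(3)], of t] T_Q by simp

lemma biharmonic_imp_constant_curvature: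
  assumes "biharmonic_on heis_metric I \<gamma>"
  obtains c where "\<And>t. t \<in> I \<Longrightarrow> heis_curvature \<gamma> t = c"
proof -
  have "P t \<bullet> Q t = 0" if "t \<in> I" for t
  proof -
    have "T t \<bullet> (S t + cross3 (heis_curv (cross3 (T t) (P t))) (T t)) = 0"
      using assms that by (simp add: biharmonic_on_iff)
    then show ?thesis
      using T_S [OF that] by (simp add: inner_add_right dot_cross_self)
  qed
  \<comment> \<open>The squared curvature is differentiated, since the curvature itself might vanish
    here and fail to be differentiable.\<close>
  then have "((\<lambda>s. P s \<bullet> P s) has_real_derivative 0) (at t within I)" if "t \<in> I" for t
    using inner_derivatives(3) [OF that] that DERIV_subset by fastforce
  then obtain d where "P t \<bullet> P t = d" if "t \<in> I" for t
    using has_field_derivative_zero_constant [of I "\<lambda>s. P s \<bullet> P s"] interval_I is_interval_convex_1 by metis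
  then show ?thesis
    by (intro that [of "sqrt d"]) (simp add: heis_curvature_eq norm_eq_sqrt_inner)
qed

end

section \<open>Frenet frame for constant nonzero curvature\<close>

lemma cross3_orthonormal_expansion:
  assumes "u \<bullet> u = 1" "v \<bullet> v = 1" "u \<bullet> v = 0"
  shows "x = (x \<bullet> u) *\<^sub>R u + (x \<bullet> v) *\<^sub>R v + (x \<bullet> cross3 u v) *\<^sub>R cross3 u v"
proof -
  define y where "y = x - ((x \<bullet> u) *\<^sub>R u + (x \<bullet> v) *\<^sub>R v + (x \<bullet> cross3 u v) *\<^sub>R cross3 u v)"
  have b: "cross3 u v \<bullet> cross3 u v = 1"
    using assms by (simp add: dot_cross)
  have "v \<bullet> u = 0"
    using assms(3) by (simp add: inner_commute)
  then have "y \<bullet> u = 0" "y \<bullet> v = 0" "y \<bullet> cross3 u v = 0"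
    using assms b dot_cross_self(3,4)
    by (simp_all add: y_def inner_diff_left inner_add_left dot_cross_self)
  moreover have "cross3 y (cross3 u v) = (y \<bullet> v) *\<^sub>R u - (y \<bullet> u) *\<^sub>R v"
    by (rule Lagrange)
  \<comment> \<open>The remainder \<open>y\<close> is both orthogonal and parallel to the unit
    vector \<open>cross3 u v\<close>.\<close>
  ultimately have "y = 0 \<or> cross3 u v = 0"
    using norm_and_cross_eq_0 [of y "cross3 u v"] by simp
  then have "y = 0"
    using b by auto
  then show ?thesis
    by (simp add: y_def)
qed

text \<open>For constant curvature the normal is a constant multiple of \<open>P\<close>, so no root
  or quotient has to be differentiated.\<close>

locale constant_curvature_heis_curve = unit_speed_heis_curve +
  fixes c :: real
  assumes c_nz: "c \<noteq> 0" and curvature: "\<And>t. t \<in> I \<Longrightarrow> heis_curvature \<gamma> t = c"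
begin

definition N :: "real \<Rightarrow> real^3" where "N t = (1 / c) *\<^sub>R P t"
definition B :: "real \<Rightarrow> real^3" where "B t = cross3 (T t) (N t)"
text \<open>The candidate for the torsion: \<open>Q\<close> is \<open>c\<close> times the covariant
  derivative of \<open>N\<close>, whose component along \<open>B\<close> is minus the
  torsion.\<close>

definition r :: "real \<Rightarrow> real" where "r t = - (1 / c) * (Q t \<bullet> B t)"

lemma smooth_NB: "smooth_on I N" "smooth_on I B"
proof -
  show "smooth_on I N"
    unfolding N_def [abs_def] by (intro smooth_on_scaleR smooth_on_const smooth_TPQ)
  then show "smooth_on I B"
    unfolding B_def [abs_def] by (intro smooth_on_cross3 smooth_TPQ)
qed

lemma P_eq: "P t = c *\<^sub>R N t"
  using c_nz by (simp add: N_def)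

lemma P_P: "t \<in> I \<Longrightarrow> P t \<bullet> P t = c\<^sup>2"
  using curvature heis_curvature_eq by (metis dot_square_norm)

lemma P_Q: "t \<in> I \<Longrightarrow> P t \<bullet> Q t = 0"
  using derivative_unique_on [OF inner_derivatives(3) DERIV_const, of t "c\<^sup>2"] P_P by simp

lemma P_S: "t \<in> I \<Longrightarrow> P t \<bullet> S t = - (Q t \<bullet> Q t)"
  using derivative_unique_on [OF inner_derivatives(5) DERIV_const, of t 0] P_Q by simp

lemma orthonormal:
  assumes "t \<in> I"
  shows "T t \<bullet> T t = 1" "N t \<bullet> N t = 1" "B t \<bullet> B t = 1"
    "T t \<bullet> N t = 0" "T t \<bullet> B t = 0" "N t \<bullet> B t = 0" "B t \<bullet> N t = 0"
proof -
  show T: "T t \<bullet> T t = 1" by (rule T_T [OF assms])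
  show N: "N t \<bullet> N t = 1"
    using P_P [OF assms] c_nz by (simp add: N_def power2_eq_square)
  show TN: "T t \<bullet> N t = 0"
    using T_P [OF assms] by (simp add: N_def)
  show "B t \<bullet> B t = 1"
    using T N TN by (simp add: B_def dot_cross inner_commute)
  show "T t \<bullet> B t = 0" "N t \<bullet> B t = 0" "B t \<bullet> N t = 0"
    by (simp_all add: B_def dot_cross_self)
qed

lemma frame_expansion:
  "t \<in> I \<Longrightarrow> x = (x \<bullet> T t) *\<^sub>R T t + (x \<bullet> N t) *\<^sub>R N t + (x \<bullet> B t) *\<^sub>R B t"
  unfolding B_def by (intro cross3_orthonormal_expansion orthonormal)

lemma Q_eq:
  assumes "t \<in> I"
  shows "Q t = - c\<^sup>2 *\<^sub>R T t - (c * r t) *\<^sub>R B t"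
proof -
  have "Q t \<bullet> T t = - c\<^sup>2" "Q t \<bullet> N t = 0" "Q t \<bullet> B t = - (c * r t)"
    using T_Q [OF assms] P_P [OF assms] P_Q [OF assms] c_nz
    by (simp_all add: N_def r_def inner_commute)
  then show ?thesis
    using frame_expansion [OF assms, of "Q t"] by simp
qed

lemma frenet_N:
  assumes "t \<in> I"
  shows "frame_cov T N t = - c *\<^sub>R T t - r t *\<^sub>R B t"
proof -
  have "frame_cov T N t = (1 / c) *\<^sub>R Q t"
    unfolding N_def [abs_def] Q_def by (rule frame_cov_scaleR [OF smooth_TPQ(2) assms])
  then show ?thesis
    using c_nz by (simp add: Q_eq [OF assms] scaleR_diff_right power2_eq_square)
qed

lemma T_cross_B:
  assumes "t \<in> I"
  shows "cross3 (T t) (B t) = - N t"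
  unfolding B_def using orthonormal [OF assms] by (simp add: Lagrange)

lemma B_cross_T: "t \<in> I \<Longrightarrow> cross3 (B t) (T t) = N t"
  using T_cross_B cross_skew by (metis minus_minus)

text \<open>In the product rule for \<open>B\<close> the terms \<open>P \<times> N\<close> and
  \<open>T \<times> T\<close> vanish, which leaves \<open>- r\<close> times
  \<open>T \<times> B = - N\<close>.\<close>

lemma frenet_B:
  assumes "t \<in> I"
  shows "frame_cov T B t = r t *\<^sub>R N t"
proof -
  have "frame_cov T B t = cross3 (P t) (N t) + cross3 (T t) (frame_cov T N t)"
    unfolding B_def [abs_def] P_def by (rule frame_cov_cross3 [OF smooth_TPQ(1) smooth_NB(1) assms])
  then show ?thesis
    by (simp add: P_eq frenet_N [OF assms] Cross3.right_diff_distrib cross_mult_left cross_mult_right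
      T_cross_B [OF assms])
qed

lemma heis_comp_NB:
  assumes "t \<in> I"
  shows "heis_comp (\<gamma> t) (heis_N \<gamma> t) = N t" "heis_comp (\<gamma> t) (heis_B \<gamma> t) = B t"
proof -
  show N: "heis_comp (\<gamma> t) (heis_N \<gamma> t) = N t"
    by (simp only: heis_N_def curvature [OF assms] heis_comp_linear heis_comp_nabla_T [OF assms] N_def)
  show "heis_comp (\<gamma> t) (heis_B \<gamma> t) = B t"
    unfolding heis_B_def heis_comp_cross N B_def T_def ..
qed

text \<open>The Frenet formulas make \<open>r t\<close> a solution; it is the only one, since the
  second equation compares multiples of the nonzero vector \<open>N t\<close>.\<close>

lemma heis_torsion_eq:
  assumes "t \<in> I"
  shows "heis_torsion \<gamma> t = r t"
  unfolding heis_torsion_def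
proof (rule the_equality)
  have N: "heis_comp (\<gamma> t) (heis_nabla \<gamma> (heis_N \<gamma>) t) = - c *\<^sub>R T t - r t *\<^sub>R B t"
    using heis_comp_nabla [OF smooth_NB(1) assms heis_comp_NB(1)] frenet_N [OF assms] by simp
  have B: "heis_comp (\<gamma> t) (heis_nabla \<gamma> (heis_B \<gamma>) t) = r t *\<^sub>R N t"
    using heis_comp_nabla [OF smooth_NB(2) assms heis_comp_NB(2)] frenet_B [OF assms] by simp
  have eqB: "heis_nabla \<gamma> (heis_B \<gamma>) t = x *\<^sub>R heis_N \<gamma> t \<longleftrightarrow> r t *\<^sub>R N t = x *\<^sub>R N t" for x
    by (subst heis_comp_inject [of "\<gamma> t", symmetric]) (simp only: B heis_comp_NB [OF assms] heis_comp_linear)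
  show "heis_nabla \<gamma> (heis_N \<gamma>) t = - heis_curvature \<gamma> t *\<^sub>R velocity \<gamma> t - r t *\<^sub>R heis_B \<gamma> t \<and>
    heis_nabla \<gamma> (heis_B \<gamma>) t = r t *\<^sub>R heis_N \<gamma> t"
  proof
    show "heis_nabla \<gamma> (heis_N \<gamma>) t = - heis_curvature \<gamma> t *\<^sub>R velocity \<gamma> t - r t *\<^sub>R heis_B \<gamma> t"
      by (subst heis_comp_inject [of "\<gamma> t", symmetric])
         (simp only: N heis_comp_linear heis_comp_NB [OF assms] curvature [OF assms] T_def)
  qed (simp add: eqB)
  fix x
  assume "heis_nabla \<gamma> (heis_N \<gamma>) t = - heis_curvature \<gamma> t *\<^sub>R velocity \<gamma> t - x *\<^sub>R heis_B \<gamma> t \<and>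
    heis_nabla \<gamma> (heis_B \<gamma>) t = x *\<^sub>R heis_N \<gamma> t"
  then have "r t *\<^sub>R N t = x *\<^sub>R N t"
    by (simp add: eqB)
  moreover have "N t \<noteq> 0"
    using orthonormal(2) [OF assms] by auto
  ultimately show "x = r t"
    by simp
qed

section \<open>Torsion derivative and bitension field in the Frenet frame\<close>

lemma torsion_derivative:
  assumes "t \<in> I"
  shows "(heis_torsion \<gamma> has_real_derivative - (1 / c) * (S t \<bullet> B t)) (at t)"
proof -
  have "((\<lambda>s. Q s \<bullet> B s) has_real_derivative S t \<bullet> B t + Q t \<bullet> (r t *\<^sub>R N t)) (at t)"
    using frame_cov_inner [OF smooth_TPQ(3) smooth_NB(2) assms, of T] frenet_B [OF assms]
    by (simp add: S_def)
  \<comment> \<open>This removes the term in which \<open>B\<close> is differentiated.\<close>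
  moreover have "Q t \<bullet> N t = 0"
    using P_Q [OF assms] c_nz by (simp add: N_def inner_commute)
  ultimately have "(r has_real_derivative - (1 / c) * (S t \<bullet> B t)) (at t)"
    unfolding r_def [abs_def] by (intro DERIV_cmult) simp
  then show ?thesis
    by (rule has_field_derivative_transform_within_open [OF _ open_I assms]) (simp add: heis_torsion_eq)
qed

text \<open>Here \<open>T \<times> P = c B\<close>, and \<open>heis_curv\<close> splits
  \<open>B\<close> into \<open>B/4\<close> and a multiple of the third axis. The triple products of
  that axis with pairs from \<open>T\<close>, \<open>N\<close>, \<open>B\<close> expand its cross
  product with \<open>T\<close>.\<close>

lemma curvature_term:
  assumes "t \<in> I"
  shows "cross3 (heis_curv (cross3 (T t) (P t))) (T t) =
    c *\<^sub>R ((1/4 - (B t $ 3)\<^sup>2) *\<^sub>R N t + (N t $ 3 * B t $ 3) *\<^sub>R B t)" (is "?R = _")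
proof -
  let ?e = "axis 3 1 :: real^3"
  have R: "?R = c *\<^sub>R ((1/4) *\<^sub>R N t - B t $ 3 *\<^sub>R cross3 ?e (T t))"
    by (simp add: P_eq cross_mult_right B_def [symmetric] heis_curv_def Cross3.left_diff_distrib
      cross_mult_left B_cross_T [OF assms] scaleR_diff_right)
  have e: "?e \<bullet> x = x $ 3" for x
    by (simp add: inner_axis_axis inner_axis')
  have "cross3 ?e (T t) \<bullet> N t = B t $ 3"
    by (metis B_def cross_triple e inner_commute)
  moreover have "cross3 ?e (T t) \<bullet> B t = - N t $ 3"
    by (metis T_cross_B [OF assms] cross_triple e inner_commute inner_minus_right vector_minus_component)
  moreover have "cross3 ?e (T t) \<bullet> T t = 0"
    by (simp add: dot_cross_self)
  ultimately have "cross3 ?e (T t) = B t $ 3 *\<^sub>R N t - N t $ 3 *\<^sub>R B t"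
    using frame_expansion [OF assms, of "cross3 ?e (T t)"] by simp
  then show ?thesis
    unfolding R by (simp only:) (simp add: algebra_simps power2_eq_square)
qed

text \<open>The normal component follows from \<open>P \<bullet> S = - (Q \<bullet> Q)\<close>. The
  component along \<open>B\<close> stays as it is, since \<open>torsion_derivative\<close> relates
  it to the derivative of the torsion.\<close>

lemma S_eq:
  assumes "t \<in> I"
  shows "S t = - (c * (c\<^sup>2 + (r t)\<^sup>2)) *\<^sub>R N t + (S t \<bullet> B t) *\<^sub>R B t"
proof -
  have "S t \<bullet> T t = 0"
    using T_S [OF assms] P_Q [OF assms] by (simp add: inner_commute)
  moreover have "S t \<bullet> N t = - (c * (c\<^sup>2 + (r t)\<^sup>2))"
  proof -
    have "Q t \<bullet> Q t = c\<^sup>2 * (c\<^sup>2 + (r t)\<^sup>2)"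
      unfolding Q_eq [OF assms] using orthonormal [OF assms]
      by (simp add: inner_diff_left inner_diff_right inner_commute power2_eq_square algebra_simps)
    then show ?thesis
      using P_S [OF assms] c_nz by (simp add: N_def inner_commute power2_eq_square)
  qed
  ultimately show ?thesis
    using frame_expansion [OF assms, of "S t"] by simp
qed

lemma bitension_zero_iff:
  assumes "t \<in> I"
  shows "S t + cross3 (heis_curv (cross3 (T t) (P t))) (T t) = 0 \<longleftrightarrow>
    c\<^sup>2 + (r t)\<^sup>2 = 1/4 - (B t $ 3)\<^sup>2 \<and> - (1 / c) * (S t \<bullet> B t) = N t $ 3 * B t $ 3"
proof -
  \<comment> \<open>The components of the bitension field along \<open>N\<close> and
    \<open>B\<close>; the one along \<open>T\<close> is zero.\<close>
  define x y where "x = c * (1/4 - (B t $ 3)\<^sup>2 - (c\<^sup>2 + (r t)\<^sup>2))" and "y = S t \<bullet> B t + c * (N t $ 3 * B t $ 3)"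
  have "S t + cross3 (heis_curv (cross3 (T t) (P t))) (T t) = x *\<^sub>R N t + y *\<^sub>R B t"
    by (subst S_eq [OF assms]) (simp add: curvature_term [OF assms] x_def y_def algebra_simps)
  moreover have "x *\<^sub>R N t + y *\<^sub>R B t = 0 \<longleftrightarrow> x = 0 \<and> y = 0"
  proof
    assume "x *\<^sub>R N t + y *\<^sub>R B t = 0"
    then have "(x *\<^sub>R N t + y *\<^sub>R B t) \<bullet> N t = 0" "(x *\<^sub>R N t + y *\<^sub>R B t) \<bullet> B t = 0"
      by simp_all
    then show "x = 0 \<and> y = 0"
      using orthonormal [OF assms] by (simp add: inner_add_left)
  qed simp
  moreover have "x = 0 \<longleftrightarrow> c\<^sup>2 + (r t)\<^sup>2 = 1/4 - (B t $ 3)\<^sup>2"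
    using c_nz by (auto simp: x_def)
  moreover have "y = 0 \<longleftrightarrow> - (1 / c) * (S t \<bullet> B t) = N t $ 3 * B t $ 3"
    using c_nz by (simp add: y_def field_simps) linarith
  ultimately show ?thesis
    by simp
qed

lemma biharmonic_on_iff_frenet:
  "biharmonic_on heis_metric I \<gamma> \<longleftrightarrow>
      (\<forall>t\<in>I. (heis_curvature \<gamma> t)\<^sup>2 + (heis_torsion \<gamma> t)\<^sup>2
               = 1/4 - (heis_comp (\<gamma> t) (heis_B \<gamma> t) $ 3)\<^sup>2) \<and>
      (\<forall>t\<in>I. (heis_torsion \<gamma> has_real_derivative
               heis_comp (\<gamma> t) (heis_N \<gamma> t) $ 3 * heis_comp (\<gamma> t) (heis_B \<gamma> t) $ 3) (at t))"
proof -
  \<comment> \<open>The torsion is already known to be differentiable, so the derivative condition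
    becomes an equation for a known value.\<close>
  have "(heis_torsion \<gamma> has_real_derivative d) (at t) \<longleftrightarrow> - (1 / c) * (S t \<bullet> B t) = d"
    if "t \<in> I" for t d
    using torsion_derivative [OF that] DERIV_unique by blast
  then have "(\<forall>t\<in>I. (heis_torsion \<gamma> has_real_derivative
        heis_comp (\<gamma> t) (heis_N \<gamma> t) $ 3 * heis_comp (\<gamma> t) (heis_B \<gamma> t) $ 3) (at t)) \<longleftrightarrow>
      (\<forall>t\<in>I. - (1 / c) * (S t \<bullet> B t) = N t $ 3 * B t $ 3)"
    by (intro ball_cong refl) (simp only: heis_comp_NB)
  moreover have "(\<forall>t\<in>I. (heis_curvature \<gamma> t)\<^sup>2 + (heis_torsion \<gamma> t)\<^sup>2
        = 1/4 - (heis_comp (\<gamma> t) (heis_B \<gamma> t) $ 3)\<^sup>2) \<longleftrightarrow>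
      (\<forall>t\<in>I. c\<^sup>2 + (r t)\<^sup>2 = 1/4 - (B t $ 3)\<^sup>2)"
    by (intro ball_cong refl) (simp only: heis_comp_NB curvature heis_torsion_eq)
  ultimately show ?thesis
    unfolding biharmonic_on_iff using bitension_zero_iff by (simp only: ball_conj_distrib [symmetric]) blast
qed

text \<open>A point of \<open>I\<close> is required: over the empty set every curve counts as a
  geodesic.\<close>

lemma not_geodesic: "\<not> geodesic_on heis_metric I \<gamma>"
  using nonempty_I P_P c_nz by (fastforce simp: geodesic_on_iff)

end

section \<open>The characterization of non-geodesic biharmonic curves\<close>

theorem theorem3p1:
  fixes I :: "real set" and \<gamma> :: "real \<Rightarrow> real^3"
  assumes "open I" and "is_interval I" and "I \<noteq> {}"
    and "smooth_curve_on I \<gamma>"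
    and "arc_length_param_on heis_metric I \<gamma>"
  shows "(\<not> geodesic_on heis_metric I \<gamma> \<and> biharmonic_on heis_metric I \<gamma>) \<longleftrightarrow>
     ((\<exists>c. c \<noteq> 0 \<and> (\<forall>t\<in>I. heis_curvature \<gamma> t = c)) \<and>
      (\<forall>t\<in>I. (heis_curvature \<gamma> t)\<^sup>2 + (heis_torsion \<gamma> t)\<^sup>2
               = 1/4 - (heis_comp (\<gamma> t) (heis_B \<gamma> t) $ 3)\<^sup>2) \<and>
      (\<forall>t\<in>I. (heis_torsion \<gamma> has_real_derivative
               heis_comp (\<gamma> t) (heis_N \<gamma> t) $ 3 * heis_comp (\<gamma> t) (heis_B \<gamma> t) $ 3) (at t)))"
    (is "?L \<longleftrightarrow> ?C \<and> ?F")
proof -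
  interpret unit_speed_heis_curve I \<gamma>
    using assms by unfold_locales
  have const: "constant_curvature_heis_curve I \<gamma> c"
    if "c \<noteq> 0" "\<forall>t\<in>I. heis_curvature \<gamma> t = c" for c
    using that by unfold_locales auto
  \<comment> \<open>Both sides entail \<open>?C\<close>, so the remaining equivalence may be proved
    with the Frenet frame available.\<close>
  have "?C" if L: ?L
  proof -
    from L obtain c where c: "heis_curvature \<gamma> t = c" if "t \<in> I" for t
      using biharmonic_imp_constant_curvature by blast
    \<comment> \<open>For \<open>c = 0\<close> the field \<open>P\<close> would vanish on
      \<open>I\<close>, making the curve a geodesic.\<close>
    moreover have "c \<noteq> 0"
      using L c by (auto simp: geodesic_on_iff heis_curvature_eq)
    ultimately show ?C
      by blast
  qed
  moreover have "?L \<longleftrightarrow> ?F" if C: ?C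
  proof -
    from C obtain c where "c \<noteq> 0" "\<forall>t\<in>I. heis_curvature \<gamma> t = c"
      by blast
    then interpret constant_curvature_heis_curve I \<gamma> c
      by (rule const)
    show ?thesis
      using biharmonic_on_iff_frenet not_geodesic by blast
  qed
  ultimately show ?thesis
    by blast
qed

end
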